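(* Let $r\ge1$, let $p_1,\dots,p_r\ge5$ be distinct primes, and $P=p_1\cdots p_r$. Let $n$ be a positive integer. If $n\ge 3P$, then $g_P(2n)>0$.
   Context: $M=6P$. $g_P(2n)$ is the number of pairs $(h,k)\in\mathbb Z_{>0}^2$ with $h+k=2n$, $h\le k$, $\gcd(h,M)=\gcd(k,M)=1$. *)

theory Defs
  imports "HOL-Computational_Algebra.Primes"
begin

definition M :: "nat \<Rightarrow> nat" where
  "M P = 6 * P"

text \<open>The second argument of \<open>g\<close> is the sum \<open>h + k\<close> itself, so the number of pairs with sum
  \<open>2n\<close> is \<open>g P (2 * n)\<close>.  The set is finite, so \<open>card\<close> is a genuine count.\<close>

definition g :: "nat \<Rightarrow> nat \<Rightarrow> nat" where
  "g P m = card {(h, k). h > 0 \<and> k > 0 \<and> h + k = m \<and> h \<le> k \<and> gcd h (M P) = 1 \<and> gcd k (M P) = 1}"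

end

theory Submission
  imports Defs "HOL-Number_Theory.Cong"
begin

text \<open>By the Chinese remainder theorem choose \<open>h < 6P\<close> whose residue modulo each prime \<open>q\<close> dividing
  \<open>6P\<close> is neither \<open>0\<close> nor \<open>2n\<close>.  One of the residues \<open>1\<close> and \<open>2\<close> always qualifies, because \<open>1\<close> does
  for \<open>q = 2\<close>.  As \<open>6P \<le> 2n\<close>, the complement \<open>2n - h\<close> is positive.\<close>

lemma ex_residue_avoiding_0_and_even:
  fixes q m :: nat
  assumes "prime q" and "even m"
  shows "\<exists>u. \<not> [u = 0] (mod q) \<and> \<not> [u = m] (mod q)"
proof (cases "[1 = m] (mod q)")
  case True
  \<comment> \<open>For \<open>q = 2\<close> the case assumption would make \<open>m\<close> odd.
    For larger \<open>q\<close>, 2 differs from 0 and from 1, which is the residue of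
    \<open>m\<close>.\<close>
  have "q \<noteq> 2"
    using True \<open>even m\<close> by (auto simp: cong_def)
  then have "q > 2"
    using prime_gt_1_nat[OF \<open>prime q\<close>] by linarith
  then have "\<not> [2 = 0] (mod q)" "\<not> [2 = 1] (mod q)"
    by (simp_all add: cong_def)
  moreover have "\<not> [2 = m] (mod q)"
    using True \<open>\<not> [2 = 1] (mod q)\<close> by (simp add: cong_def)
  ultimately show ?thesis by blast
next
  case False
  then show ?thesis
    using prime_gt_1_nat[OF \<open>prime q\<close>] by (intro exI[of _ 1]) (simp add: cong_def)
qed

lemma coprime_prod_primesI:
  fixes a :: nat
  assumes "\<And>q. q \<in> S \<Longrightarrow> prime q" and "\<And>q. q \<in> S \<Longrightarrow> \<not> q dvd a"
  shows "coprime a (\<Prod>S)"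
  using assms by (intro prod_coprime_right) (metis coprime_commute prime_imp_coprime)

text \<open>The modulus is a product of distinct primes, so both coprimality conditions split into
  one condition per prime. Evenness leaves a residue free at 2, where an odd \<open>m\<close> would
  exclude both classes.\<close>

lemma ex_coprime_summands:
  fixes S :: "nat set" and m :: nat
  assumes "finite S" and primes: "\<And>q. q \<in> S \<Longrightarrow> prime q"
    and "even m" and "\<Prod>S \<le> m"
  shows "\<exists>h<m. coprime h (\<Prod>S) \<and> coprime (m - h) (\<Prod>S)"
proof -
  obtain u where u: "\<And>q. q \<in> S \<Longrightarrow> \<not> [u q = 0] (mod q) \<and> \<not> [u q = m] (mod q)"
    using ex_residue_avoiding_0_and_even[OF primes \<open>even m\<close>] by metis
  have "\<forall>q\<in>S. \<forall>q'\<in>S. q \<noteq> q' \<longrightarrow> coprime q q'"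
    using primes primes_coprime by blast
  then obtain x where x: "\<And>q. q \<in> S \<Longrightarrow> [x = u q] (mod q)"
    using chinese_remainder_nat[of S "\<lambda>q. q" u] \<open>finite S\<close> by auto
  \<comment> \<open>Reduction keeps the residue modulo each \<open>q\<close> in \<open>S\<close> and
    brings \<open>h\<close> below \<open>m\<close>, so \<open>m - h\<close> is a true
    difference.\<close>
  define h where "h = x mod \<Prod>S"
  have "\<Prod>S > 0"
    using primes by (intro prod_pos) (simp add: prime_gt_0_nat)
  then have "h < m"
    using \<open>\<Prod>S \<le> m\<close> unfolding h_def by (rule mod_less_divisor[THEN order.strict_trans2])
  have h: "[h = u q] (mod q)" if "q \<in> S" for q
  proof -
    have "q dvd \<Prod>S"
      using dvd_prodI[of S q "\<lambda>q. q"] that \<open>finite S\<close> by simp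
    then show ?thesis
      using x[OF that] by (simp add: h_def cong_def mod_mod_cancel)
  qed
  have "\<not> q dvd h" if "q \<in> S" for q
    using u[OF that] h[OF that] by (simp add: cong_def dvd_eq_mod_eq_0)
  moreover have "\<not> q dvd (m - h)" if "q \<in> S" for q
  proof
    assume "q dvd (m - h)"
    then have "[h = m] (mod q)"
      using \<open>h < m\<close> by (simp add: cong_sym_eq[of h] cong_altdef_nat)
    then show False
      using u[OF that] h[OF that] by (simp add: cong_def)
  qed
  ultimately show ?thesis
    using \<open>h < m\<close> coprime_prod_primesI[of S, OF primes] by blast
qed

theorem theorem5p9:
  fixes r n P :: nat and p :: "nat \<Rightarrow> nat"
  assumes "r \<ge> 1"
    and "\<And>i. i \<in> {1..r} \<Longrightarrow> prime (p i)"
    and "\<And>i. i \<in> {1..r} \<Longrightarrow> p i \<ge> 5"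
    and "inj_on p {1..r}"
    and "P = (\<Prod>i\<in>{1..r}. p i)"
    and "n > 0"
    and "n \<ge> 3 * P"
  shows "g P (2 * n) > 0"
proof -
  define T where "T = p ` {1..r}"
  \<comment> \<open>\<open>S\<close> collects the primes of \<open>6 * P\<close>; the bound 5 keeps
    2 and 3 out of \<open>T\<close>, so no factor repeats.\<close>
  define S where "S = insert 2 (insert 3 T)"
  have T: "prime q" "q \<ge> 5" if "q \<in> T" for q
    using that assms(2,3) by (auto simp: T_def)
  have "2 \<notin> T" "3 \<notin> T" "finite T"
    using T(2)[of 2] T(2)[of 3] by (auto simp: T_def)
  moreover have "P = \<Prod>T"
    using assms(4,5) by (simp add: T_def prod.reindex)
  ultimately have M: "M P = \<Prod>S" "finite S"
    by (auto simp: S_def M_def)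
  have "\<And>q. q \<in> S \<Longrightarrow> prime q"
    using T(1) by (auto simp: S_def)
  moreover have "\<Prod>S \<le> 2 * n"
    using assms(7) M(1) by (simp add: M_def)
  ultimately obtain h where h: "h < 2 * n" "coprime h (M P)" "coprime (2 * n - h) (M P)"
    using ex_coprime_summands[of S "2 * n"] M by auto
  \<comment> \<open>0 is coprime only to 1, and \<open>6 * P\<close> is never 1.\<close>
  have "h > 0"
    using h(2) by (cases h) (auto simp: M_def)
  define A where "A = {(h, k). h > 0 \<and> k > 0 \<and> h + k = 2 * n \<and> h \<le> k \<and>
    gcd h (M P) = 1 \<and> gcd k (M P) = 1}"
  \<comment> \<open>The residues do not decide which summand is smaller, so the pair is
    sorted.\<close>
  have "(min h (2 * n - h), max h (2 * n - h)) \<in> A"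
    using h \<open>h > 0\<close> by (auto simp: A_def min_def max_def coprime_iff_gcd_eq_1)
  \<comment> \<open>An infinite set would have \<open>card\<close> 0, so a member alone does not
    give positivity.\<close>
  moreover have "finite A"
    by (rule finite_subset[of _ "{..2 * n} \<times> {..2 * n}"]) (auto simp: A_def)
  ultimately show ?thesis
    unfolding g_def A_def[symmetric] by (auto simp: card_gt_0_iff)
qed

end
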